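(* Let $F_n$ be the free group of rank $n$, $\varphi\in\mathrm{Aut}(F_n)$, $G=F_n\rtimes_\varphi\mathbb{Z}$ and $\overline{G}=F_n^{ab}\rtimes_{\overline{\varphi}}\mathbb{Z}$. The following statements are equivalent: (a) $\gamma_\omega(G)=F_n$; (b) $\gamma_\omega(\overline{G})=F_n^{ab}$; (c) the matrix $[\overline{\varphi}]-E$ lies in $\mathrm{GL}_n(\mathbb{Z})$, which is equivalent to $\Delta_{\langle t\rangle}F_n^{ab}=F_n^{ab}$.
   Context: $G=F_n\rtimes_\varphi\mathbb{Z}=\langle x_1,\dots,x_n,t\mid t^{-1}x_it=\varphi(x_i),\ i=1,\dots,n\rangle$, where $\mathbb{Z}=\langle t\rangle$. $F_n^{ab}=F_n/\gamma_2(F_n)\cong\mathbb{Z}^n$; $\overline{\varphi}$ is the automorphism of $F_n^{ab}$ induced by $\varphi$, $[\overline{\varphi}]$ its matrix, and $E$ the identity matrix; in $\overline G$ the generator $t$ acts on $F_n^{ab}$ by $\overline{\varphi}$. $\gamma_1(G)=G$, $\gamma_{k+1}(G)=[\gamma_k(G),G]$, $\gamma_\omega(G)=\bigcap_{k\ge1}\gamma_k(G)$. $\Delta_{\langle t\rangle}$ is the augmentation ideal of $\mathbb{Z}[\langle t\rangle]$, which acts on $F_n^{ab}$ with $t$ acting via $\overline{\varphi}$. *)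

theory Defs
  imports
    "Jordan_Normal_Form.Matrix"
    "HOL-Library.Poly_Mapping"
    "HOL-Algebra.Algebra"
begin

section \<open>Free groups of finite rank\<close>

text \<open>The letter \<open>(i, True)\<close> stands for \<open>x\<^sub>i\<close> and \<open>(i, False)\<close> for its inverse; the generators
  are indexed by \<open>{..<n}\<close>. Elements of the free group are reduced words, and the product of two
  reduced words is the reduced form of their concatenation.\<close>

type_synonym letter = "nat \<times> bool"

definition inv_letter :: "letter \<Rightarrow> letter" where
  "inv_letter a = (fst a, \<not> snd a)"

definition reduced :: "letter list \<Rightarrow> bool" where
  "reduced w \<longleftrightarrow> successively (\<lambda>a b. b \<noteq> inv_letter a) w"

definition push_letter :: "letter \<Rightarrow> letter list \<Rightarrow> letter list" where
  "push_letter a w = (if w \<noteq> [] \<and> hd w = inv_letter a then tl w else a # w)"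

definition free_group :: "nat \<Rightarrow> letter list monoid" where
  "free_group n =
    \<lparr>carrier = {w. reduced w \<and> fst ` set w \<subseteq> {..<n}},
     mult = (\<lambda>u v. foldr push_letter u v),
     one = []\<rparr>"

definition free_gen :: "nat \<Rightarrow> letter list" where
  "free_gen i = [(i, True)]"


section \<open>Lower central series\<close>

definition commutator_subgroup ::
    "('a, 'b) monoid_scheme \<Rightarrow> 'a set \<Rightarrow> 'a set \<Rightarrow> 'a set" where
  "commutator_subgroup G H K =
    generate G (\<Union>h\<in>H. \<Union>k\<in>K. {h \<otimes>\<^bsub>G\<^esub> k \<otimes>\<^bsub>G\<^esub> inv\<^bsub>G\<^esub> h \<otimes>\<^bsub>G\<^esub> inv\<^bsub>G\<^esub> k})"

text \<open>The series is indexed from \<open>1\<close>; the value at \<open>0\<close> is a dummy.\<close>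

fun lower_central :: "('a, 'b) monoid_scheme \<Rightarrow> nat \<Rightarrow> 'a set" where
  "lower_central G 0 = carrier G"
| "lower_central G (Suc 0) = carrier G"
| "lower_central G (Suc (Suc k)) =
     commutator_subgroup G (lower_central G (Suc k)) (carrier G)"

definition lower_central_omega :: "('a, 'b) monoid_scheme \<Rightarrow> 'a set" where
  "lower_central_omega G = (\<Inter>k\<in>{1..}. lower_central G k)"


section \<open>Abelianization\<close>

definition abelianization :: "('a, 'b) monoid_scheme \<Rightarrow> 'a set monoid" where
  "abelianization G = G Mod lower_central G 2"

text \<open>The elements of the quotient are cosets, so the induced automorphism takes images of cosets.\<close>

definition induced_auto ::
    "('a, 'b) monoid_scheme \<Rightarrow> ('a \<Rightarrow> 'a) \<Rightarrow> ('a set \<Rightarrow> 'a set)" where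
  "induced_auto G \<phi> = (\<lambda>C\<in>carrier (abelianization G). \<phi> ` C)"

definition free_ab_gen :: "nat \<Rightarrow> nat \<Rightarrow> letter list set" where
  "free_ab_gen n i = lower_central (free_group n) 2 #>\<^bsub>free_group n\<^esub> free_gen i"


section \<open>Semidirect products with the infinite cyclic group\<close>

text \<open>The pair \<open>(k, x)\<close> stands for \<open>t\<^sup>k x\<close>. With \<open>t\<^sup>-\<^sup>1 x t = \<phi> x\<close> this gives
  \<open>(t\<^sup>k x) (t\<^sup>l y) = t\<^sup>k\<^sup>+\<^sup>l \<phi>\<^sup>l(x) y\<close>. The normal factor \<open>N\<close> is embedded as \<open>{0} \<times> carrier N\<close>,
  and \<open>t\<close> is \<open>(1, \<one>)\<close>.\<close>

definition semidirect_int ::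
    "('a, 'b) monoid_scheme \<Rightarrow> ('a \<Rightarrow> 'a) \<Rightarrow> (int \<times> 'a) monoid" where
  "semidirect_int N \<phi> =
    \<lparr>carrier = UNIV \<times> carrier N,
     mult = (\<lambda>(k, x) (l, y). (k + l, (\<phi> [^]\<^bsub>AutoGroup N\<^esub> l) x \<otimes>\<^bsub>N\<^esub> y)),
     one = (0, \<one>\<^bsub>N\<^esub>)\<rparr>"

definition semidirect_kernel :: "('a, 'b) monoid_scheme \<Rightarrow> (int \<times> 'a) set" where
  "semidirect_kernel N = {0} \<times> carrier N"


section \<open>Matrices over the integers\<close>

text \<open>The matrix of an endomorphism \<open>f\<close> of a free abelian group \<open>A\<close> with basis \<open>b 0, \<dots>, b (n - 1)\<close>,
  with the coordinates of \<open>f (b j)\<close> in column \<open>j\<close>. The group \<open>A\<close> is written multiplicatively.\<close>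

definition endo_matrix ::
    "('a, 'b) monoid_scheme \<Rightarrow> nat \<Rightarrow> (nat \<Rightarrow> 'a) \<Rightarrow> ('a \<Rightarrow> 'a) \<Rightarrow> int mat" where
  "endo_matrix A n b f =
    (THE M. M \<in> carrier_mat n n \<and>
       (\<forall>j<n. f (b j) = finprod A (\<lambda>i. b i [^]\<^bsub>A\<^esub> (M $$ (i, j))) {..<n}))"

definition GL_int :: "nat \<Rightarrow> int mat set" where
  "GL_int n = Units (ring_mat TYPE(int) n ())"


section \<open>The group ring of the infinite cyclic group\<close>

text \<open>The type \<open>int \<Rightarrow>\<^sub>0 int\<close> with its convolution product is the group ring \<open>\<int>[\<langle>t\<rangle>]\<close>; the group
  element \<open>t\<^sup>k\<close> is \<open>Poly_Mapping.single k 1\<close>.\<close>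

definition augmentation :: "(int \<Rightarrow>\<^sub>0 int) \<Rightarrow> int" where
  "augmentation u = (\<Sum>k\<in>Poly_Mapping.keys u. Poly_Mapping.lookup u k)"

definition augmentation_ideal :: "(int \<Rightarrow>\<^sub>0 int) set" where
  "augmentation_ideal = {u. augmentation u = 0}"

text \<open>The action of the group ring on an abelian group \<open>A\<close>, written multiplicatively, on which \<open>t\<close>
  acts by the automorphism \<open>f\<close>: the element \<open>\<Sum>\<^sub>k u\<^sub>k t\<^sup>k\<close> sends \<open>a\<close> to \<open>\<Sum>\<^sub>k u\<^sub>k f\<^sup>k(a)\<close>.\<close>

definition group_ring_act ::
    "('a, 'b) monoid_scheme \<Rightarrow> ('a \<Rightarrow> 'a) \<Rightarrow> (int \<Rightarrow>\<^sub>0 int) \<Rightarrow> 'a \<Rightarrow> 'a" where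
  "group_ring_act A f u a =
    finprod A (\<lambda>k. (f [^]\<^bsub>AutoGroup A\<^esub> k) a [^]\<^bsub>A\<^esub> Poly_Mapping.lookup u k) (Poly_Mapping.keys u)"

definition ideal_smult ::
    "('a, 'b) monoid_scheme \<Rightarrow> ('a \<Rightarrow> 'a) \<Rightarrow> (int \<Rightarrow>\<^sub>0 int) set \<Rightarrow> 'a set" where
  "ideal_smult A f I = generate A {group_ring_act A f u a | u a. u \<in> I \<and> a \<in> carrier A}"

end

theory Submission
  imports Defs "Jordan_Normal_Form.Determinant"
begin

text \<open>For a semidirect product \<open>S = N \<rtimes> \<langle>t\<rangle>\<close> with \<open>t\<close> acting by \<open>f\<close>, let \<open>A\<close> be the
  abelianization of \<open>N\<close> and \<open>g\<close> the automorphism of \<open>A\<close> induced by \<open>f\<close>. Then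
  \<open>\<gamma>\<^sub>\<omega>(S) = N\<close> if and only if \<open>(g - 1) A = A\<close>. On the one hand every commutator of \<open>S\<close> lies in
  \<open>N\<close> and maps into \<open>(g - 1) A\<close>. On the other hand, if \<open>(g - 1) A = A\<close>, then every element of \<open>N\<close>
  is the product of some \<open>y\<^sup>-\<^sup>1 f(y) \<in> [N, S]\<close> and an element of \<open>[N, N]\<close>, so \<open>N = [N, S]\<close> and
  \<open>N\<close> stays in all terms of the series. This criterion applies equally to \<open>N = F\<^sub>n\<close> and to
  \<open>N = F\<^sub>n\<^sup>a\<^sup>b\<close>, with the same \<open>A\<close> and \<open>g\<close>. Moreover \<open>(g - 1) A\<close> is the product of \<open>A\<close> with the
  augmentation ideal, and since the exponent sums are coordinates on \<open>F\<^sub>n\<^sup>a\<^sup>b\<close>, its being all of \<open>A\<close>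
  means that the matrix of \<open>g - 1\<close> is surjective on \<open>\<int>\<^sup>n\<close>, hence invertible.\<close>

section \<open>Free groups\<close>

lemma inv_letter_inv_letter [simp]: "inv_letter (inv_letter a) = a"
  by (simp add: inv_letter_def)

lemma fst_inv_letter [simp]: "fst (inv_letter a) = fst a"
  by (simp add: inv_letter_def)

lemma reduced_Cons:
  "reduced (a # w) \<longleftrightarrow> reduced w \<and> (w = [] \<or> hd w \<noteq> inv_letter a)"
  by (cases w) (auto simp: reduced_def)

lemma reduced_push_letter: "reduced w \<Longrightarrow> reduced (push_letter a w)"
  by (cases w) (auto simp: push_letter_def reduced_Cons)

text \<open>If pushing \<open>a\<close> deletes the head of \<open>w\<close>, then reducedness keeps
  \<open>a\<close> from being the next letter, so pushing \<open>inv_letter a\<close> puts the head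
  back; otherwise the second push cancels the first.\<close>

lemma push_letter_inv_cancel:
  "reduced w \<Longrightarrow> push_letter (inv_letter a) (push_letter a w) = w"
  by (cases w) (auto simp: push_letter_def reduced_Cons)

lemma push_letter_inv_cancel':
  "reduced w \<Longrightarrow> push_letter a (push_letter (inv_letter a) w) = w"
  using push_letter_inv_cancel[of w "inv_letter a"] by simp

lemma reduced_foldr_push_letter: "reduced w \<Longrightarrow> reduced (foldr push_letter u w)"
  by (induction u) (auto simp: reduced_push_letter)

lemma fst_set_push_letter: "fst ` set (push_letter a w) \<subseteq> insert (fst a) (fst ` set w)"
  by (cases w) (auto simp: push_letter_def)

lemma fst_set_foldr_push_letter:
  "fst ` set (foldr push_letter u w) \<subseteq> fst ` set u \<union> fst ` set w"
proof (induction u)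
  case (Cons a u)
  then show ?case
    using fst_set_push_letter[of a "foldr push_letter u w"] by simp blast
qed simp

text \<open>This is the heart of associativity: reducing a word first does not change how it acts on
  reduced words, because a cancelled pair of letters acts as the identity.\<close>

lemma foldr_push_letter_push:
  assumes "reduced w"
  shows "foldr push_letter (push_letter a v) w = push_letter a (foldr push_letter v w)"
proof (cases "v \<noteq> [] \<and> hd v = inv_letter a")
  case True
  then have "foldr push_letter v w = push_letter (inv_letter a) (foldr push_letter (tl v) w)"
    by (cases v) auto
  with True show ?thesis
    using push_letter_inv_cancel'[OF reduced_foldr_push_letter[OF assms]]
    by (simp add: push_letter_def)
qed (auto simp: push_letter_def)

lemma foldr_push_letter_assoc:
  assumes "reduced w"
  shows "foldr push_letter (foldr push_letter u v) w = foldr push_letter u (foldr push_letter v w)"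
  using assms by (induction u) (auto simp: foldr_push_letter_push)

lemma foldr_push_letter_Nil: "reduced w \<Longrightarrow> foldr push_letter w [] = w"
proof (induction w)
  case (Cons a w)
  then show ?case
    by (auto simp: reduced_Cons push_letter_def)
qed simp

lemma successively_rev_map:
  "successively P (rev (map f w)) \<longleftrightarrow> successively (\<lambda>a b. P (f b) (f a)) w"
  by (simp add: successively_rev successively_map)

lemma reduced_inverse_word: "reduced w \<Longrightarrow> reduced (rev (map inv_letter w))"
  unfolding reduced_def successively_rev_map
  by (erule successively_mono) auto

lemma foldr_push_letter_inverse_word:
  "foldr push_letter (rev (map inv_letter w)) (foldr push_letter w v) = v" if "reduced v"
  using that
  by (induction w) (simp_all add: push_letter_inv_cancel reduced_foldr_push_letter)

lemma carrier_free_group: "carrier (free_group n) = {w. reduced w \<and> fst ` set w \<subseteq> {..<n}}"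
  and mult_free_group: "u \<otimes>\<^bsub>free_group n\<^esub> v = foldr push_letter u v"
  and one_free_group: "\<one>\<^bsub>free_group n\<^esub> = []"
  by (simp_all add: free_group_def)

lemma group_free_group: "group (free_group n)"
proof (rule groupI)
  fix x y assume "x \<in> carrier (free_group n)" "y \<in> carrier (free_group n)"
  then show "x \<otimes>\<^bsub>free_group n\<^esub> y \<in> carrier (free_group n)"
    using fst_set_foldr_push_letter[of x y]
    by (simp add: carrier_free_group mult_free_group reduced_foldr_push_letter) blast
next
  show "\<one>\<^bsub>free_group n\<^esub> \<in> carrier (free_group n)"
    by (simp add: carrier_free_group one_free_group reduced_def)
next
  fix x assume x: "x \<in> carrier (free_group n)"
  then have "rev (map inv_letter x) \<in> carrier (free_group n)"
    by (auto simp: carrier_free_group reduced_inverse_word)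
  moreover have "rev (map inv_letter x) \<otimes>\<^bsub>free_group n\<^esub> x = \<one>\<^bsub>free_group n\<^esub>"
    using x foldr_push_letter_inverse_word[of "[]" x]
    by (simp add: carrier_free_group mult_free_group one_free_group foldr_push_letter_Nil)
       (simp add: reduced_def)
  ultimately show
    "\<exists>y\<in>carrier (free_group n). y \<otimes>\<^bsub>free_group n\<^esub> x = \<one>\<^bsub>free_group n\<^esub>"
    by blast
qed (simp_all add: carrier_free_group mult_free_group one_free_group foldr_push_letter_assoc)

section \<open>Exponent sums\<close>

text \<open>As \<open>i\<close> varies these are the coordinates of the abelianization map from the
  free group to \<int>^n.\<close>

definition exponent_sum :: "letter list \<Rightarrow> nat \<Rightarrow> int" where
  "exponent_sum w i = (\<Sum>a\<leftarrow>w. if fst a = i then (if snd a then 1 else - 1) else 0)"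

lemma exponent_sum_Nil [simp]: "exponent_sum [] i = 0"
  by (simp add: exponent_sum_def)

lemma exponent_sum_Cons:
  "exponent_sum (a # w) i = exponent_sum [a] i + exponent_sum w i"
  by (simp add: exponent_sum_def)

text \<open>Cancellation removes two letters with opposite contributions, so reduction preserves
  exponent sums.\<close>

lemma exponent_sum_push_letter:
  "exponent_sum (push_letter a w) i = exponent_sum [a] i + exponent_sum w i"
  by (cases w) (auto simp: push_letter_def exponent_sum_def inv_letter_def)

lemma exponent_sum_mult:
  "exponent_sum (u \<otimes>\<^bsub>free_group n\<^esub> v) i = exponent_sum u i + exponent_sum v i"
  unfolding mult_free_group
proof (induction u)
  case (Cons a u)
  then show ?case
    by (simp add: exponent_sum_push_letter exponent_sum_Cons[of a u])
qed simp

lemma exponent_sum_free_gen: "exponent_sum (free_gen j) i = (if i = j then 1 else 0)"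
  by (simp add: exponent_sum_def free_gen_def)

lemma exponent_sum_inv:
  assumes "u \<in> carrier (free_group n)"
  shows "exponent_sum (inv\<^bsub>free_group n\<^esub> u) i = - exponent_sum u i"
proof -
  interpret group "free_group n" by (rule group_free_group)
  have "exponent_sum (inv\<^bsub>free_group n\<^esub> u) i + exponent_sum u i = 0"
    using assms exponent_sum_mult[of n "inv\<^bsub>free_group n\<^esub> u" u i]
    by (simp add: one_free_group)
  then show ?thesis
    by simp
qed

lemma lower_central_2: "lower_central G 2 = derived G (carrier G)"
  by (simp add: numeral_2_eq_2 commutator_subgroup_def derived_def)

text \<open>The words of exponent sum 0 form the kernel of a homomorphism to an abelian group and so
  contain all commutators.\<close>

lemma exponent_sum_derived:
  assumes "w \<in> lower_central (free_group n) 2"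
  shows "exponent_sum w i = 0"
proof -
  interpret F: group "free_group n" by (rule group_free_group)
  have "subgroup {w \<in> carrier (free_group n). exponent_sum w i = 0} (free_group n)"
    by (rule F.subgroupI)
       (auto simp: exponent_sum_mult exponent_sum_inv intro!: exI[of _ "\<one>\<^bsub>free_group n\<^esub>"],
        simp add: one_free_group)
  then have "derived (free_group n) (carrier (free_group n))
      \<subseteq> {w \<in> carrier (free_group n). exponent_sum w i = 0}"
    unfolding derived_def
    by (rule F.generate_subgroup_incl[rotated])
       (auto simp: exponent_sum_mult exponent_sum_inv)
  with assms show ?thesis
    by (auto simp: lower_central_2)
qed

section \<open>Powers of an automorphism\<close>

abbreviation aut_pow :: "('a, 'b) monoid_scheme \<Rightarrow> ('a \<Rightarrow> 'a) \<Rightarrow> int \<Rightarrow> 'a \<Rightarrow> 'a" where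
  "aut_pow N f k \<equiv> f [^]\<^bsub>AutoGroup N\<^esub> k"

locale group_auto = group N for N :: "('a, 'b) monoid_scheme" (structure) +
  fixes f :: "'a \<Rightarrow> 'a"
  assumes f_auto: "f \<in> auto N"
begin

lemma carrier_AutoGroup: "carrier (AutoGroup N) = auto N"
  by (simp add: AutoGroup_def)

lemma aut_pow_auto: "aut_pow N f k \<in> auto N"
  using group.int_pow_closed[OF AutoGroup, of f k] f_auto by (simp add: carrier_AutoGroup)

lemma aut_pow_hom: "aut_pow N f k \<in> hom N N"
  using aut_pow_auto by (simp add: auto_def)

lemma f_hom: "f \<in> hom N N"
  using f_auto by (simp add: auto_def)

lemma f_closed [simp]: "x \<in> carrier N \<Longrightarrow> f x \<in> carrier N"
  using f_hom by (rule hom_in_carrier)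

lemma f_mult: "x \<in> carrier N \<Longrightarrow> y \<in> carrier N \<Longrightarrow> f (x \<otimes> y) = f x \<otimes> f y"
  using f_hom by (rule hom_mult)

lemma f_inv: "x \<in> carrier N \<Longrightarrow> f (inv x) = inv (f x)"
  using group_hom.hom_inv[of N N f x] f_hom is_group
  by (simp add: group_hom_def group_hom_axioms_def)

lemma aut_pow_closed [simp]: "x \<in> carrier N \<Longrightarrow> aut_pow N f k x \<in> carrier N"
  using aut_pow_hom by (rule hom_in_carrier)

lemma aut_pow_mult:
  "x \<in> carrier N \<Longrightarrow> y \<in> carrier N \<Longrightarrow> aut_pow N f k (x \<otimes> y) = aut_pow N f k x \<otimes> aut_pow N f k y"
  using aut_pow_hom by (rule hom_mult)

lemma aut_pow_one [simp]: "aut_pow N f k \<one> = \<one>"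
  using aut_pow_hom is_group by (simp add: hom_one)

lemma aut_pow_inv: "x \<in> carrier N \<Longrightarrow> aut_pow N f k (inv x) = inv (aut_pow N f k x)"
  using group_hom.hom_inv[of N N "aut_pow N f k" x] aut_pow_hom is_group
  by (simp add: group_hom_def group_hom_axioms_def)

lemma one_AutoGroup_apply [simp]: "x \<in> carrier N \<Longrightarrow> \<one>\<^bsub>AutoGroup N\<^esub> x = x"
  by (simp add: AutoGroup_def BijGroup_def)

lemma aut_pow_1 [simp]: "aut_pow N f 1 = f"
  using group.int_pow_1[OF AutoGroup] f_auto by (simp add: carrier_AutoGroup)

lemma aut_pow_add:
  assumes "x \<in> carrier N"
  shows "aut_pow N f (k + l) x = aut_pow N f k (aut_pow N f l x)"
proof -
  have "aut_pow N f (k + l) = aut_pow N f k \<otimes>\<^bsub>AutoGroup N\<^esub> aut_pow N f l"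
    using group.int_pow_mult[OF AutoGroup, of f k l] f_auto by (simp add: carrier_AutoGroup)
  also have "\<dots> = compose (carrier N) (aut_pow N f k) (aut_pow N f l)"
    using aut_pow_auto[of k] aut_pow_auto[of l]
    by (simp add: AutoGroup_def BijGroup_def auto_def)
  finally show ?thesis
    using assms by (simp add: compose_eq)
qed

lemma aut_pow_minus_cancel [simp]:
  "x \<in> carrier N \<Longrightarrow> aut_pow N f k (aut_pow N f (- k) x) = x"
  "x \<in> carrier N \<Longrightarrow> aut_pow N f (- k) (aut_pow N f k x) = x"
  by (simp_all flip: aut_pow_add)

lemma aut_pow_commute: "x \<in> carrier N \<Longrightarrow> f (aut_pow N f k x) = aut_pow N f k (f x)"
  using aut_pow_add[of x 1 k] aut_pow_add[of x k 1] by (simp add: add.commute)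

end

text \<open>This transfers the twisted multiplication of a semidirect product along
  \<open>\<pi>\<close>, where only compatibility with the automorphisms themselves is known.\<close>

lemma aut_pow_intertwine:
  assumes "group_auto N \<phi>" "group_auto A f" and \<pi>: "\<pi> \<in> carrier N \<rightarrow> carrier A"
    and comm: "\<And>x. x \<in> carrier N \<Longrightarrow> \<pi> (\<phi> x) = f (\<pi> x)"
    and x: "x \<in> carrier N"
  shows "\<pi> (aut_pow N \<phi> k x) = aut_pow A f k (\<pi> x)"
proof -
  interpret N: group_auto N \<phi> by fact
  interpret A: group_auto A f by fact
  have \<pi>_closed: "\<pi> y \<in> carrier A" if "y \<in> carrier N" for y
    using \<pi> that by blast
  have pow_int: "\<pi> (aut_pow N \<phi> (int m) y) = aut_pow A f (int m) (\<pi> y)"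
    if "y \<in> carrier N" for y m
  proof (induction m)
    case (Suc m)
    have "\<pi> (aut_pow N \<phi> (int (Suc m)) y) = f (\<pi> (aut_pow N \<phi> (int m) y))"
      using that by (simp add: N.aut_pow_add comm)
    also have "\<dots> = aut_pow A f (int (Suc m)) (\<pi> y)"
      using that \<pi>_closed by (simp add: A.aut_pow_add Suc)
    finally show ?case .
  qed (use that \<pi>_closed in simp)
  show ?thesis
  proof (cases k rule: int_cases2)
    case (nonneg m)
    then show ?thesis using pow_int x by simp
  next
    case (nonpos m)
    \<comment> \<open>A negative power is reduced to the nonnegative case, applied to the preimage
      of \<open>x\<close> under the \<open>m\<close>-th power.\<close>
    have "\<pi> x = \<pi> (aut_pow N \<phi> (int m) (aut_pow N \<phi> (- int m) x))"
      using x by simp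
    also have "\<dots> = aut_pow A f (int m) (\<pi> (aut_pow N \<phi> (- int m) x))"
      using x by (subst pow_int) simp_all
    finally show ?thesis
      using x \<pi>_closed nonpos by simp
  qed
qed

section \<open>The image of an automorphism minus the identity\<close>

text \<open>In additive notation this is (f - 1)A, the condition to which all the statements are
  reduced.\<close>

definition aut_diff :: "('a, 'b) monoid_scheme \<Rightarrow> ('a \<Rightarrow> 'a) \<Rightarrow> 'a set" where
  "aut_diff A f = (\<lambda>a. f a \<otimes>\<^bsub>A\<^esub> inv\<^bsub>A\<^esub> a) ` carrier A"

locale comm_group_auto = comm_group A + group_auto A f for A :: "('a, 'b) monoid_scheme" (structure) and f
begin

text \<open>Commutativity makes \<open>f a \<otimes> inv a\<close> a homomorphism in
  \<open>a\<close>, and this is its image.\<close>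

lemma subgroup_aut_diff: "subgroup (aut_diff A f) A"
proof (rule subgroupI)
  show "aut_diff A f \<noteq> {}"
    by (auto simp: aut_diff_def)
next
  fix x assume "x \<in> aut_diff A f"
  then obtain a where a: "a \<in> carrier A" "x = f a \<otimes> inv a"
    by (auto simp: aut_diff_def)
  then have "inv x = f (inv a) \<otimes> inv (inv a)"
    by (simp add: f_inv inv_mult)
  with a show "inv x \<in> aut_diff A f"
    unfolding aut_diff_def by blast
next
  fix x y assume "x \<in> aut_diff A f" "y \<in> aut_diff A f"
  then obtain a b where ab: "a \<in> carrier A" "x = f a \<otimes> inv a" "b \<in> carrier A" "y = f b \<otimes> inv b"
    by (auto simp: aut_diff_def)
  then have "x \<otimes> y = f (a \<otimes> b) \<otimes> inv (a \<otimes> b)"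
    by (simp add: f_mult inv_mult m_ac)
  with ab show "x \<otimes> y \<in> aut_diff A f"
    unfolding aut_diff_def by blast
qed (auto simp: aut_diff_def)

text \<open>The powers of \<open>f\<close> commute with f - 1.\<close>

lemma aut_pow_aut_diff:
  assumes "x \<in> aut_diff A f"
  shows "aut_pow A f k x \<in> aut_diff A f"
proof -
  obtain a where a: "a \<in> carrier A" "x = f a \<otimes> inv a"
    using assms by (auto simp: aut_diff_def)
  then have "aut_pow A f k x = f (aut_pow A f k a) \<otimes> inv (aut_pow A f k a)"
    by (simp add: aut_pow_mult aut_pow_inv aut_pow_commute)
  with a show ?thesis
    unfolding aut_diff_def by (auto intro!: imageI)
qed

text \<open>In additive notation, f^(m+1) - 1 = (f - 1)f^m + (f^m - 1) gives the nonnegative powers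
  by induction, and f^(-m) - 1 = -(f^m - 1)f^(-m) gives the others.\<close>

lemma aut_pow_diff_mem:
  assumes a: "a \<in> carrier A"
  shows "aut_pow A f k a \<otimes> inv a \<in> aut_diff A f"
proof -
  interpret D: subgroup "aut_diff A f" A by (rule subgroup_aut_diff)
  have pow_int: "aut_pow A f (int m) a \<otimes> inv a \<in> aut_diff A f" if a: "a \<in> carrier A" for a m
  proof (induction m)
    case (Suc m)
    let ?b = "aut_pow A f (int m) a"
    have "f ?b \<otimes> inv ?b \<in> aut_diff A f"
      using a by (simp add: aut_diff_def)
    then have "(f ?b \<otimes> inv ?b) \<otimes> (?b \<otimes> inv a) \<in> aut_diff A f"
      using Suc.IH by (rule D.m_closed)
    also have "(f ?b \<otimes> inv ?b) \<otimes> (?b \<otimes> inv a) = f ?b \<otimes> (inv ?b \<otimes> ?b) \<otimes> inv a"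
      using a by (simp only: m_assoc m_closed inv_closed f_closed aut_pow_closed)
    finally show ?case
      using a by (simp add: aut_pow_add)
  qed (use a in simp)
  show ?thesis
  proof (cases k rule: int_cases2)
    case (nonneg m)
    then show ?thesis using pow_int a by simp
  next
    case (nonpos m)
    let ?b = "aut_pow A f (- int m) a"
    have "inv (aut_pow A f (int m) ?b \<otimes> inv ?b) \<in> aut_diff A f"
      using a by (intro D.m_inv_closed pow_int) simp
    then show ?thesis
      using a nonpos by (simp add: inv_mult m_comm)
  qed
qed

text \<open>When the coefficients sum to 0, the sum of the u_k t^k equals the sum of the u_k (t^k -
  1), and every t^k - 1 maps into (f - 1)A.\<close>

lemma group_ring_act_mem:
  assumes "u \<in> augmentation_ideal" "a \<in> carrier A"
  shows "group_ring_act A f u a \<in> aut_diff A f"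
proof -
  interpret D: subgroup "aut_diff A f" A by (rule subgroup_aut_diff)
  let ?K = "Poly_Mapping.keys u" and ?u = "Poly_Mapping.lookup u"
  have fin_mem: "finprod A g K \<in> aut_diff A f" if "\<And>k. k \<in> K \<Longrightarrow> g k \<in> aut_diff A f" "finite K"
    for g :: "int \<Rightarrow> 'a" and K
    using that(2,1)
  proof (induction K rule: finite_induct)
    case (insert k K)
    then show ?case
      by (subst finprod_insert) (auto intro!: D.m_closed)
  qed simp
  have pow_sum: "finprod A (\<lambda>k. a [^] ?u k) K = a [^] (\<Sum>k\<in>K. ?u k)" if "finite K" for K
    using that assms(2)
    by (induction K rule: finite_induct) (auto simp: int_pow_mult)
  \<comment> \<open>Each factor is split as (f^k a - a) + a. The second parts combine to
    \<open>a\<close> raised to the augmentation of \<open>u\<close>, which is trivial.\<close>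
  have "group_ring_act A f u a
      = finprod A (\<lambda>k. (aut_pow A f k a \<otimes> inv a) [^] ?u k \<otimes> a [^] ?u k) ?K"
    unfolding group_ring_act_def
  proof (rule finprod_cong')
    fix k assume "k \<in> ?K"
    have "(aut_pow A f k a \<otimes> inv a) [^] ?u k \<otimes> a [^] ?u k
        = ((aut_pow A f k a \<otimes> inv a) \<otimes> a) [^] ?u k"
      using assms(2) by (simp add: int_pow_distrib)
    then show "aut_pow A f k a [^] ?u k = (aut_pow A f k a \<otimes> inv a) [^] ?u k \<otimes> a [^] ?u k"
      using assms(2) by (simp add: m_assoc)
  qed (use assms(2) in auto)
  also have "\<dots> = finprod A (\<lambda>k. (aut_pow A f k a \<otimes> inv a) [^] ?u k) ?K \<otimes> finprod A (\<lambda>k. a [^] ?u k) ?K"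
    using assms(2) by (intro finprod_multf) auto
  also have "finprod A (\<lambda>k. a [^] ?u k) ?K = \<one>"
    using assms by (simp add: pow_sum augmentation_ideal_def augmentation_def)
  also have "finprod A (\<lambda>k. (aut_pow A f k a \<otimes> inv a) [^] ?u k) ?K \<otimes> \<one>
      = finprod A (\<lambda>k. (aut_pow A f k a \<otimes> inv a) [^] ?u k) ?K"
    using assms(2) by (intro r_one finprod_closed) auto
  also have "\<dots> \<in> aut_diff A f"
    by (intro fin_mem subgroup_int_pow_closed subgroup_aut_diff aut_pow_diff_mem assms) simp
  finally show ?thesis .
qed

text \<open>The element \<open>u\<close> is t - 1, so this one element of the augmentation ideal
  already produces all of (f - 1)A.\<close>

lemma aut_diff_eq_group_ring_act:
  assumes "a \<in> carrier A"
  defines "u \<equiv> Poly_Mapping.single 1 1 - Poly_Mapping.single 0 1"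
  shows "u \<in> augmentation_ideal" "group_ring_act A f u a = f a \<otimes> inv a"
proof -
  have lookup: "Poly_Mapping.lookup u k = (if k = 1 then 1 else if k = 0 then - 1 else 0)" for k
    by (simp add: u_def lookup_minus lookup_single lookup_one when_def)
  then have keys: "Poly_Mapping.keys u = {0, 1}"
    by (auto simp: in_keys_iff split: if_splits)
  show "u \<in> augmentation_ideal"
    by (simp add: augmentation_ideal_def augmentation_def keys lookup)
  have "a [^] (- 1 :: int) = inv a"
    using assms(1) by (simp add: int_pow_neg)
  with assms(1) show "group_ring_act A f u a = f a \<otimes> inv a"
    by (simp add: group_ring_act_def keys lookup m_comm)
qed

lemma ideal_smult_augmentation_ideal: "ideal_smult A f augmentation_ideal = aut_diff A f"
proof
  show "ideal_smult A f augmentation_ideal \<subseteq> aut_diff A f"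
    unfolding ideal_smult_def
    by (rule generate_subgroup_incl[OF _ subgroup_aut_diff]) (auto intro: group_ring_act_mem)
  show "aut_diff A f \<subseteq> ideal_smult A f augmentation_ideal"
  proof
    fix x assume "x \<in> aut_diff A f"
    then obtain a where a: "a \<in> carrier A" "x = f a \<otimes> inv a"
      by (auto simp: aut_diff_def)
    then show "x \<in> ideal_smult A f augmentation_ideal"
      unfolding ideal_smult_def
      using aut_diff_eq_group_ring_act[OF a(1)] by (intro generate.incl CollectI) metis
  qed
qed

end

section \<open>The lower central series of a semidirect product\<close>

context group_auto
begin

abbreviation "S \<equiv> semidirect_int N f"

lemma carrier_semidirect_int: "carrier S = UNIV \<times> carrier N"
  and mult_semidirect_int: "(k, x) \<otimes>\<^bsub>S\<^esub> (l, y) = (k + l, aut_pow N f l x \<otimes> y)"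
  and one_semidirect_int: "\<one>\<^bsub>S\<^esub> = (0, \<one>)"
  by (simp_all add: semidirect_int_def)

lemma group_semidirect_int: "group S"
proof (rule groupI)
  fix p q r assume "p \<in> carrier S" "q \<in> carrier S" "r \<in> carrier S"
  then show "p \<otimes>\<^bsub>S\<^esub> q \<otimes>\<^bsub>S\<^esub> r = p \<otimes>\<^bsub>S\<^esub> (q \<otimes>\<^bsub>S\<^esub> r)"
  proof (cases p; cases q; cases r)
    fix k x l y m z
    assume *: "p \<in> carrier S" "q \<in> carrier S" "r \<in> carrier S"
      "p = (k, x)" "q = (l, y)" "r = (m, z)"
    \<comment> \<open>Moving x past t^l and then past t^m applies f^l first; the order is harmless
      because powers of \<open>f\<close> commute.\<close>
    have "aut_pow N f (l + m) x = aut_pow N f m (aut_pow N f l x)"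
      using * by (simp add: carrier_semidirect_int flip: aut_pow_add) (simp add: add.commute)
    with * show ?thesis
      by (simp add: carrier_semidirect_int mult_semidirect_int aut_pow_mult m_assoc)
  qed
next
  fix p assume p: "p \<in> carrier S"
  obtain k x where "p = (k, x)" by (cases p)
  \<comment> \<open>The inverse of t^k x is x^(-1) t^(-k) = t^(-k) f^(-k)(x^(-1)).\<close>
  with p show "\<exists>q\<in>carrier S. q \<otimes>\<^bsub>S\<^esub> p = \<one>\<^bsub>S\<^esub>"
    by (intro bexI[of _ "(- k, aut_pow N f (- k) (inv x))"])
       (simp_all add: carrier_semidirect_int mult_semidirect_int one_semidirect_int)
qed (auto simp: carrier_semidirect_int mult_semidirect_int one_semidirect_int)

sublocale S: group S
  by (rule group_semidirect_int)

text \<open>A commutator is determined by c k h = h k, which can be checked without computing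
  inverses in \<open>S\<close>.\<close>

lemma commutator_eqI:
  assumes "h \<in> carrier S" "k \<in> carrier S" "c \<in> carrier S" "c \<otimes>\<^bsub>S\<^esub> (k \<otimes>\<^bsub>S\<^esub> h) = h \<otimes>\<^bsub>S\<^esub> k"
  shows "h \<otimes>\<^bsub>S\<^esub> k \<otimes>\<^bsub>S\<^esub> inv\<^bsub>S\<^esub> h \<otimes>\<^bsub>S\<^esub> inv\<^bsub>S\<^esub> k = c"
proof -
  have "h \<otimes>\<^bsub>S\<^esub> k = c \<otimes>\<^bsub>S\<^esub> k \<otimes>\<^bsub>S\<^esub> h"
    using assms by (simp add: S.m_assoc)
  then have "h \<otimes>\<^bsub>S\<^esub> k \<otimes>\<^bsub>S\<^esub> inv\<^bsub>S\<^esub> h = c \<otimes>\<^bsub>S\<^esub> k"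
    using assms by (metis S.inv_solve_right S.m_closed)
  then show ?thesis
    using assms by (metis S.inv_solve_right S.m_closed)
qed

section \<open>Passing between subgroups of the normal factor and of the semidirect product\<close>

lemma semidirect_kernel_subset: "semidirect_kernel N \<subseteq> carrier S"
  by (auto simp: semidirect_kernel_def carrier_semidirect_int)

lemma inv_semidirect_kernel:
  "x \<in> carrier N \<Longrightarrow> inv\<^bsub>S\<^esub> (0, x) = (0, inv x)"
  by (rule S.inv_equality)
     (simp_all add: carrier_semidirect_int mult_semidirect_int one_semidirect_int)

lemma mult_semidirect_kernel: "x \<in> carrier N \<Longrightarrow> (0, x) \<otimes>\<^bsub>S\<^esub> (0, y) = (0, x \<otimes> y)"
  by (simp add: mult_semidirect_int)

lemma subgroup_semidirect_kernel:
  assumes "subgroup H N"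
  shows "subgroup ({0} \<times> H) S"
proof -
  interpret H: subgroup H N by fact
  show ?thesis
    using H.one_closed
    by (intro S.subgroupI)
       (auto simp: carrier_semidirect_int inv_semidirect_kernel mult_semidirect_kernel
         simp del: H.one_closed)
qed

lemma subgroup_kernel_preimage:
  assumes "subgroup P S"
  shows "subgroup {x \<in> carrier N. (0, x) \<in> P} N"
proof -
  interpret P: subgroup P S by fact
  show ?thesis
    using P.one_closed P.m_closed P.m_inv_closed
    by (intro subgroupI)
       (auto simp: one_semidirect_int simp flip: inv_semidirect_kernel mult_semidirect_kernel)
qed

lemma subgroup_commutator_subgroup:
  "H \<subseteq> carrier S \<Longrightarrow> subgroup (commutator_subgroup S H (carrier S)) S"
  unfolding commutator_subgroup_def by (intro S.generate_is_subgroup) auto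

text \<open>It suffices to treat generators. The powers of t cancel in a commutator, and its image
  in \<open>A\<close> is, up to a power of \<open>g\<close>, a difference of elements g^j x - x and
  g^i y - y.\<close>

lemma lower_central_2_subset:
  assumes "comm_group A" "g \<in> auto A" "\<pi> \<in> hom N A"
    and comm: "\<And>x. x \<in> carrier N \<Longrightarrow> \<pi> (f x) = g (\<pi> x)"
  shows "lower_central S 2 \<subseteq> {0} \<times> {x \<in> carrier N. \<pi> x \<in> aut_diff A g}"
proof -
  interpret A: comm_group_auto A g
    using assms(1,2)
    by (simp add: comm_group_auto_def group_auto_def group_auto_axioms_def comm_group.axioms)
  interpret \<pi>: group_hom N A \<pi>
    using assms(3) by unfold_locales
  interpret D: subgroup "aut_diff A g" A
    by (rule A.subgroup_aut_diff)
  have pow: "\<pi> (aut_pow N f k x) = aut_pow A g k (\<pi> x)" if "x \<in> carrier N" for k x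
    using that comm
    by (intro aut_pow_intertwine) (auto intro: group_auto_axioms A.group_auto_axioms)
  let ?H = "{x \<in> carrier N. \<pi> x \<in> aut_diff A g}"
  have "subgroup ?H N"
  proof (rule subgroupI)
    have "\<one> \<in> ?H"
      by simp
    then show "?H \<noteq> {}"
      by blast
  qed auto
  then have H: "subgroup ({0} \<times> ?H) S"
    by (rule subgroup_semidirect_kernel)
  have "h \<otimes>\<^bsub>S\<^esub> k \<otimes>\<^bsub>S\<^esub> inv\<^bsub>S\<^esub> h \<otimes>\<^bsub>S\<^esub> inv\<^bsub>S\<^esub> k \<in> {0} \<times> ?H"
    if hk: "h \<in> carrier S" "k \<in> carrier S" for h k
  proof -
    obtain i x j y where xy: "h = (i, x)" "k = (j, y)" "x \<in> carrier N" "y \<in> carrier N"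
      using hk by (cases h; cases k) (auto simp: carrier_semidirect_int)
    have cancel: "inv\<^bsub>S\<^esub> a \<otimes>\<^bsub>S\<^esub> (a \<otimes>\<^bsub>S\<^esub> b) = b" if "a \<in> carrier S" "b \<in> carrier S" for a b
      using that by (simp flip: S.m_assoc)
    define c where "c = h \<otimes>\<^bsub>S\<^esub> k \<otimes>\<^bsub>S\<^esub> inv\<^bsub>S\<^esub> h \<otimes>\<^bsub>S\<^esub> inv\<^bsub>S\<^esub> k"
    have c: "c \<in> carrier S" "c \<otimes>\<^bsub>S\<^esub> (k \<otimes>\<^bsub>S\<^esub> h) = h \<otimes>\<^bsub>S\<^esub> k"
      using hk by (simp_all add: c_def S.m_assoc cancel)
    obtain m z where z: "c = (m, z)" "z \<in> carrier N"
      using c(1) by (cases c) (auto simp: carrier_semidirect_int)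
    \<comment> \<open>These are the two components of c k h = h k.\<close>
    have m: "m = 0"
      and eq: "aut_pow N f (j + i) z \<otimes> (aut_pow N f i y \<otimes> x) = aut_pow N f j x \<otimes> y"
      using c(2) by (auto simp: xy z mult_semidirect_int)
    let ?z = "aut_pow A g (j + i) (\<pi> z)" and ?x = "\<pi> x" and ?y = "\<pi> y"
    have "?z \<otimes>\<^bsub>A\<^esub> (aut_pow A g i ?y \<otimes>\<^bsub>A\<^esub> ?x) = aut_pow A g j ?x \<otimes>\<^bsub>A\<^esub> ?y"
      using arg_cong[OF eq, of \<pi>] xy z by (simp add: pow)
    then have "?z = aut_pow A g j ?x \<otimes>\<^bsub>A\<^esub> ?y \<otimes>\<^bsub>A\<^esub> inv\<^bsub>A\<^esub> (aut_pow A g i ?y \<otimes>\<^bsub>A\<^esub> ?x)"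
      using xy z by (simp add: A.inv_solve_right)
    also have "\<dots> = (aut_pow A g j ?x \<otimes>\<^bsub>A\<^esub> inv\<^bsub>A\<^esub> ?x)
        \<otimes>\<^bsub>A\<^esub> inv\<^bsub>A\<^esub> (aut_pow A g i ?y \<otimes>\<^bsub>A\<^esub> inv\<^bsub>A\<^esub> ?y)"
      using xy by (simp add: A.inv_mult A.m_ac)
    also have "\<dots> \<in> aut_diff A g"
      using xy by (intro D.m_closed D.m_inv_closed A.aut_pow_diff_mem) simp_all
    \<comment> \<open>Stability of (g - 1)A under powers of \<open>g\<close> allows the twist on
      \<open>\<pi> z\<close> to be undone.\<close>
    finally have "aut_pow A g (- (j + i)) ?z \<in> aut_diff A g"
      by (rule A.aut_pow_aut_diff)
    then have "\<pi> z \<in> aut_diff A g"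
      using z by (simp del: minus_add_distrib)
    with m z show ?thesis
      by (simp flip: c_def)
  qed
  then show ?thesis
    unfolding lower_central_2 derived_def
    by (intro S.generate_subgroup_incl[OF _ H]) blast
qed

text \<open>Since (g - 1)A = A, each x agrees in \<open>A\<close> with some y^(-1) f(y), a
  commutator with t^(-1); the remaining factor lies in [N, N].\<close>

lemma semidirect_kernel_subset_commutator_subgroup:
  assumes "comm_group A" "g \<in> auto A" "\<pi> \<in> hom N A" "\<pi> ` carrier N = carrier A"
    and comm: "\<And>x. x \<in> carrier N \<Longrightarrow> \<pi> (f x) = g (\<pi> x)"
    and ker: "\<And>x. x \<in> carrier N \<Longrightarrow> \<pi> x = \<one>\<^bsub>A\<^esub> \<Longrightarrow> x \<in> lower_central N 2"
    and diff: "aut_diff A g = carrier A"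
  shows "semidirect_kernel N \<subseteq> commutator_subgroup S (semidirect_kernel N) (carrier S)"
proof -
  interpret A: comm_group_auto A g
    using assms(1,2)
    by (simp add: comm_group_auto_def group_auto_def group_auto_axioms_def comm_group.axioms)
  interpret \<pi>: group_hom N A \<pi>
    using assms(3) by unfold_locales
  let ?C = "commutator_subgroup S (semidirect_kernel N) (carrier S)"
  have C: "h \<otimes>\<^bsub>S\<^esub> k \<otimes>\<^bsub>S\<^esub> inv\<^bsub>S\<^esub> h \<otimes>\<^bsub>S\<^esub> inv\<^bsub>S\<^esub> k \<in> ?C"
    if "h \<in> semidirect_kernel N" "k \<in> carrier S" for h k
    unfolding commutator_subgroup_def using that by (intro generate.incl) blast
  \<comment> \<open>Pulling [N, S] back to \<open>N\<close> lets the rest of the argument take place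
    inside \<open>N\<close>.\<close>
  define P where "P = {x \<in> carrier N. (0, x) \<in> ?C}"
  have "subgroup P N"
    unfolding P_def
    by (rule subgroup_kernel_preimage[OF
        subgroup_commutator_subgroup[OF semidirect_kernel_subset]])
  then interpret P: subgroup P N .
  have diff_mem: "inv y \<otimes> f y \<in> P" if y: "y \<in> carrier N" for y
  proof -
    have cancel: "aut_pow N f (- 1) (f y) = y"
      using y aut_pow_minus_cancel(2)[of y 1] by simp
    \<comment> \<open>The pair (-1, 1) is t^(-1), and y^(-1) t^(-1) y t = y^(-1) f(y).\<close>
    have eq: "(0, inv y) \<otimes>\<^bsub>S\<^esub> (- 1, \<one>) \<otimes>\<^bsub>S\<^esub> inv\<^bsub>S\<^esub> (0, inv y) \<otimes>\<^bsub>S\<^esub> inv\<^bsub>S\<^esub> (- 1, \<one>)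
        = (0, inv y \<otimes> f y)"
    proof (rule commutator_eqI)
      show "(0, inv y \<otimes> f y) \<otimes>\<^bsub>S\<^esub> ((- 1, \<one>) \<otimes>\<^bsub>S\<^esub> (0, inv y)) = (0, inv y) \<otimes>\<^bsub>S\<^esub> (- 1, \<one>)"
        using y by (simp add: mult_semidirect_int aut_pow_mult m_assoc cancel)
    qed (use y in \<open>simp_all add: carrier_semidirect_int\<close>)
    have "(0, inv y \<otimes> f y) \<in> ?C"
      unfolding eq[symmetric] using y
      by (intro C) (simp_all add: semidirect_kernel_def carrier_semidirect_int)
    then show ?thesis
      unfolding P_def using y by simp
  qed
  have comm_mem: "h \<otimes> k \<otimes> inv h \<otimes> inv k \<in> P" if hk: "h \<in> carrier N" "k \<in> carrier N" for h k
  proof -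
    have eq: "(0, h) \<otimes>\<^bsub>S\<^esub> (0, k) \<otimes>\<^bsub>S\<^esub> inv\<^bsub>S\<^esub> (0, h) \<otimes>\<^bsub>S\<^esub> inv\<^bsub>S\<^esub> (0, k)
        = (0, h \<otimes> k \<otimes> inv h \<otimes> inv k)"
      using hk by (simp add: inv_semidirect_kernel mult_semidirect_kernel)
    have "(0, h \<otimes> k \<otimes> inv h \<otimes> inv k) \<in> ?C"
      unfolding eq[symmetric] using hk
      by (intro C) (simp_all add: semidirect_kernel_def carrier_semidirect_int)
    then show ?thesis
      unfolding P_def using hk by simp
  qed
  have derived_mem: "lower_central N 2 \<subseteq> P"
    unfolding lower_central_2 derived_def
    by (rule generate_subgroup_incl[OF _ P.subgroup_axioms]) (use comm_mem in blast)
  have "x \<in> P" if x: "x \<in> carrier N" for x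
  proof -
    have "\<pi> x \<in> aut_diff A g"
      using x diff by simp
    then obtain y where y: "y \<in> carrier N" "\<pi> x = g (\<pi> y) \<otimes>\<^bsub>A\<^esub> inv\<^bsub>A\<^esub> \<pi> y"
      unfolding aut_diff_def assms(4)[symmetric] by blast
    let ?z = "inv y \<otimes> f y"
    \<comment> \<open>By commutativity of \<open>A\<close>, \<open>?z\<close> and \<open>x\<close>
      have the same image, so they differ by an element of the kernel of
      \<open>\<pi>\<close>.\<close>
    have "\<pi> (inv ?z \<otimes> x) = \<one>\<^bsub>A\<^esub>"
      using x y by (simp add: comm A.m_comm)
    then have "inv ?z \<otimes> x \<in> P"
      using x y by (intro subsetD[OF derived_mem] ker) simp_all
    with diff_mem[OF y(1)] have "?z \<otimes> (inv ?z \<otimes> x) \<in> P"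
      by (rule P.m_closed)
    also have "?z \<otimes> (inv ?z \<otimes> x) = x"
      using x y m_assoc[of ?z "inv ?z" x] by simp
    finally show ?thesis .
  qed
  then show ?thesis
    unfolding semidirect_kernel_def P_def by blast
qed

text \<open>The map \<open>\<pi>\<close> is kept abstract so that it can be the coset map for the
  free group and the identity for its abelianization.\<close>

theorem lower_central_omega_semidirect_int:
  assumes "comm_group A" "g \<in> auto A" "\<pi> \<in> hom N A" "\<pi> ` carrier N = carrier A"
    and comm: "\<And>x. x \<in> carrier N \<Longrightarrow> \<pi> (f x) = g (\<pi> x)"
    and ker: "\<And>x. x \<in> carrier N \<Longrightarrow> \<pi> x = \<one>\<^bsub>A\<^esub> \<Longrightarrow> x \<in> lower_central N 2"
  shows "lower_central_omega S = semidirect_kernel N \<longleftrightarrow> aut_diff A g = carrier A"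
proof
  have le: "lower_central_omega S \<subseteq> lower_central S 2"
    unfolding lower_central_omega_def by auto
  note upper = lower_central_2_subset[OF assms(1-3) comm]
  show "aut_diff A g = carrier A" if "lower_central_omega S = semidirect_kernel N"
  proof
    show "carrier A \<subseteq> aut_diff A g"
      using le upper that unfolding assms(4)[symmetric] semidirect_kernel_def by blast
    show "aut_diff A g \<subseteq> carrier A"
      using assms(1,2)
      by (intro subgroup.subset comm_group_auto.subgroup_aut_diff)
         (simp add: comm_group_auto_def group_auto_def group_auto_axioms_def comm_group.axioms)
  qed
  show "lower_central_omega S = semidirect_kernel N" if diff: "aut_diff A g = carrier A"
  proof
    show "lower_central_omega S \<subseteq> semidirect_kernel N"
      using le upper unfolding semidirect_kernel_def by blast
    \<comment> \<open>The series starts at index 1, whence \<open>Suc k\<close>. If N lies in one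
      term, then N, contained in [N, S], lies in the next.\<close>
    have "semidirect_kernel N \<subseteq> lower_central S (Suc k)" for k
    proof (induction k)
      case (Suc k)
      have "commutator_subgroup S (semidirect_kernel N) (carrier S)
          \<subseteq> lower_central S (Suc (Suc k))"
        using Suc unfolding lower_central.simps commutator_subgroup_def
        by (intro S.mono_generate) blast
      with semidirect_kernel_subset_commutator_subgroup[OF assms diff] show ?case
        by blast
    qed (simp add: semidirect_kernel_subset)
    then have "semidirect_kernel N \<subseteq> lower_central S k" if "k \<ge> 1" for k
      using that by (cases k) simp_all
    then show "semidirect_kernel N \<subseteq> lower_central_omega S"
      unfolding lower_central_omega_def by blast
  qed
qed

end

section \<open>Matrices of endomorphisms of free abelian groups\<close>

text \<open>Over the field of rationals a right inverse of a square matrix is also a left inverse,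
  and the embedding of the integers is injective on matrices.\<close>

lemma int_mat_right_inverse_imp_left_inverse:
  fixes P Q :: "int mat"
  assumes "P \<in> carrier_mat m m" "Q \<in> carrier_mat m m" "P * Q = 1\<^sub>m m"
  shows "Q * P = 1\<^sub>m m"
proof -
  let ?h = "map_mat (of_int :: int \<Rightarrow> rat)"
  have "?h P * ?h Q = 1\<^sub>m m"
    using assms by (simp flip: of_int_hom.mat_hom_mult add: of_int_hom.mat_hom_one)
  then have "?h Q * ?h P = 1\<^sub>m m"
    using assms by (intro mat_mult_left_right_inverse[of "?h P" m "?h Q"]) simp_all
  then have "?h (Q * P) = ?h (1\<^sub>m m)"
    using assms by (simp add: of_int_hom.mat_hom_mult of_int_hom.mat_hom_one)
  then show ?thesis
    by (rule of_int_hom.mat_hom_inj)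
qed

text \<open>A \<int>-basis \<open>b\<close> is encoded together with its dual coordinate functions:
  \<open>c_b\<close> yields independence and \<open>expand\<close> yields generation.\<close>

locale coordinates = comm_group_auto A f for A :: "('a, 'b) monoid_scheme" (structure) and f +
  fixes n :: nat and b :: "nat \<Rightarrow> 'a" and c :: "'a \<Rightarrow> nat \<Rightarrow> int"
  assumes b_closed: "i < n \<Longrightarrow> b i \<in> carrier A"
    and c_mult: "x \<in> carrier A \<Longrightarrow> y \<in> carrier A \<Longrightarrow> i < n \<Longrightarrow> c (x \<otimes> y) i = c x i + c y i"
    and c_b: "i < n \<Longrightarrow> j < n \<Longrightarrow> c (b j) i = (if i = j then 1 else 0)"
    and expand: "x \<in> carrier A \<Longrightarrow> x = finprod A (\<lambda>i. b i [^] c x i) {..<n}"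
begin

text \<open>The function \<open>d\<close> is arbitrary because the lemma serves both for a
  coordinate and for a coordinate composed with \<open>f\<close>.\<close>

lemma additive_finprod:
  fixes d :: "'a \<Rightarrow> int" and m :: "nat \<Rightarrow> int"
  assumes d: "\<And>x y. x \<in> carrier A \<Longrightarrow> y \<in> carrier A \<Longrightarrow> d (x \<otimes> y) = d x + d y"
  shows "d (finprod A (\<lambda>j. b j [^] m j) {..<n}) = (\<Sum>j<n. m j * d (b j))"
proof -
  have one: "d \<one> = 0"
    using d[of \<one> \<one>] by simp
  have nat_pow: "d (x [^] k) = int k * d x" if "x \<in> carrier A" for x and k :: nat
    using that by (induction k) (simp_all add: one d algebra_simps)
  have inv: "d (inv x) = - d x" if "x \<in> carrier A" for x
    using d[of "inv x" x] that one by simp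
  have int_pow: "d (x [^] k) = k * d x" if "x \<in> carrier A" for x and k :: int
    using that
    by (cases k rule: int_cases2) (simp_all add: int_pow_int int_pow_neg nat_pow inv)
  have "d (finprod A (\<lambda>j. b j [^] m j) J) = (\<Sum>j\<in>J. m j * d (b j))"
    if "finite J" "J \<subseteq> {..<n}" for J
    using that
  proof (induction J rule: finite_induct)
    case (insert j J)
    have closed: "b i [^] m i \<in> carrier A" if "i \<in> insert j J" for i
      using that insert.prems b_closed by auto
    have "d (finprod A (\<lambda>j. b j [^] m j) (insert j J))
        = d (b j [^] m j) + d (finprod A (\<lambda>j. b j [^] m j) J)"
      using insert.hyps closed by (subst finprod_insert) (auto intro!: d finprod_closed)
    then show ?case
      using insert b_closed by (simp add: int_pow)
  qed (simp add: one)
  then show ?thesis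
    by simp
qed

lemma c_finprod:
  fixes m :: "nat \<Rightarrow> int"
  assumes i: "i < n"
  shows "c (finprod A (\<lambda>j. b j [^] m j) {..<n}) i = m i"
proof -
  have "c (finprod A (\<lambda>j. b j [^] m j) {..<n}) i = (\<Sum>j<n. m j * c (b j) i)"
    using i by (intro additive_finprod c_mult)
  also have "\<dots> = (\<Sum>j<n. if i = j then m j else 0)"
    using i by (intro sum.cong) (auto simp: c_b)
  finally show ?thesis
    using i by simp
qed

lemma finprod_b_closed [simp]: "finprod A (\<lambda>j. b j [^] (m j :: int)) {..<n} \<in> carrier A"
  by (intro finprod_closed) (auto simp: b_closed)

lemma c_inject:
  assumes "x \<in> carrier A" "y \<in> carrier A" "\<And>i. i < n \<Longrightarrow> c x i = c y i"
  shows "x = y"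
proof -
  have "x = finprod A (\<lambda>i. b i [^] c x i) {..<n}"
    by (rule expand) fact
  also have "\<dots> = finprod A (\<lambda>i. b i [^] c y i) {..<n}"
    using assms(3) by (intro finprod_cong') (auto simp: b_closed)
  also have "\<dots> = y"
    by (rule expand[symmetric]) fact
  finally show ?thesis .
qed

definition matr :: "int mat" where
  "matr = mat n n (\<lambda>(i, j). c (f (b j)) i)"

text \<open>This resolves the definite description: \<open>expand\<close> gives existence, and
  reading off coordinates gives uniqueness.\<close>

lemma endo_matrix_eq: "endo_matrix A n b f = matr"
  unfolding endo_matrix_def
proof (rule the_equality, safe)
  fix j assume j: "j < n"
  then have "f (b j) = finprod A (\<lambda>i. b i [^] c (f (b j)) i) {..<n}"
    by (intro expand) (simp add: b_closed)
  also have "\<dots> = finprod A (\<lambda>i. b i [^] (matr $$ (i, j))) {..<n}"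
    using j by (intro finprod_cong') (auto simp: b_closed matr_def)
  finally show "f (b j) = finprod A (\<lambda>i. b i [^] (matr $$ (i, j))) {..<n}" .
next
  fix M :: "int mat" assume M: "M \<in> carrier_mat n n"
    and eq: "\<forall>j<n. f (b j) = finprod A (\<lambda>i. b i [^] (M $$ (i, j))) {..<n}"
  show "M = matr"
  proof (rule eq_matI)
    fix i j assume "i < dim_row matr" "j < dim_col matr"
    then show "M $$ (i, j) = matr $$ (i, j)"
      using eq by (simp add: matr_def c_finprod)
  qed (use M in \<open>auto simp: matr_def\<close>)
qed (simp add: matr_def)

section \<open>The coordinate isomorphism onto \<int>^n and the matrix of f - 1\<close>

definition coord_vec :: "'a \<Rightarrow> int vec" where
  "coord_vec x = vec n (c x)"

lemma coord_vec_carrier [simp]: "coord_vec x \<in> carrier_vec n"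
  by (simp add: coord_vec_def)

lemma coord_vec_inject:
  "x \<in> carrier A \<Longrightarrow> y \<in> carrier A \<Longrightarrow> coord_vec x = coord_vec y \<Longrightarrow> x = y"
  by (rule c_inject) (auto simp: coord_vec_def vec_eq_iff)

lemma coord_vec_surj:
  assumes "v \<in> carrier_vec n"
  obtains a where "a \<in> carrier A" "coord_vec a = v"
  using assms
  by (intro that[of "finprod A (\<lambda>j. b j [^] (v $ j)) {..<n}"])
     (auto simp: coord_vec_def c_finprod)

lemma coord_vec_diff:
  assumes a: "a \<in> carrier A"
  shows "coord_vec (f a \<otimes> inv a) = (matr - 1\<^sub>m n) *\<^sub>v coord_vec a"
proof (rule eq_vecI)
  fix i assume "i < dim_vec ((matr - 1\<^sub>m n) *\<^sub>v coord_vec a)"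
  then have i: "i < n"
    by simp
  have "c (f a) i = c (f (finprod A (\<lambda>j. b j [^] c a j) {..<n})) i"
    using expand[OF a] by simp
  also have "\<dots> = (\<Sum>j<n. c a j * c (f (b j)) i)"
    using i by (intro additive_finprod) (simp add: f_mult c_mult)
  finally have f: "c (f a) i = (\<Sum>j<n. c (f (b j)) i * c a j)"
    by (simp add: mult.commute)
  \<comment> \<open>Multiplying back by \<open>a\<close> gives the coordinate of the quotient from
    additivity alone.\<close>
  have "c (f a \<otimes> inv a) i + c a i = c (f a \<otimes> inv a \<otimes> a) i"
    using a i by (simp add: c_mult)
  also have "f a \<otimes> inv a \<otimes> a = f a"
    using a by (simp add: m_assoc)
  finally have "c (f a \<otimes> inv a) i = (\<Sum>j<n. c (f (b j)) i * c a j) - c a i"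
    by (simp add: f)
  also have "c a i = (\<Sum>j<n. (if i = j then 1 else 0) * c a j)"
    using i by (simp add: if_distrib[of "\<lambda>x. x * _ :: int"] cong: if_cong)
  also have "(\<Sum>j<n. c (f (b j)) i * c a j) - \<dots>
      = (\<Sum>j<n. (c (f (b j)) i - (if i = j then 1 else 0)) * c a j)"
    by (simp add: left_diff_distrib sum_subtractf)
  also have "\<dots> = (\<Sum>j<n. (matr - 1\<^sub>m n) $$ (i, j) * c a j)"
    using i by (intro sum.cong) (auto simp: matr_def)
  also have "\<dots> = ((matr - 1\<^sub>m n) *\<^sub>v coord_vec a) $ i"
    using i by (simp add: coord_vec_def matr_def scalar_prod_def lessThan_atLeast0)
  finally show "coord_vec (f a \<otimes> inv a) $ i = ((matr - 1\<^sub>m n) *\<^sub>v coord_vec a) $ i"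
    using i by (simp add: coord_vec_def)
qed (simp add: coord_vec_def matr_def)

text \<open>In coordinates, (f - 1)A is the image of the integer matrix \<open>?M\<close>, which is
  all of \<int>^n exactly when \<open>?M\<close> has an integral right inverse.\<close>

theorem matr_minus_one_GL_iff:
  "endo_matrix A n b f - 1\<^sub>m n \<in> GL_int n \<longleftrightarrow> aut_diff A f = carrier A"
proof -
  let ?M = "matr - 1\<^sub>m n"
  have M: "?M \<in> carrier_mat n n"
    by (simp add: matr_def minus_carrier_mat)
  have "aut_diff A f = carrier A" if "?M \<in> GL_int n"
  proof -
    from that obtain B where B: "B \<in> carrier_mat n n" "?M * B = 1\<^sub>m n"
      by (auto simp: GL_int_def Units_def ring_mat_simps)
    have "x \<in> aut_diff A f" if x: "x \<in> carrier A" for x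
    proof -
      \<comment> \<open>The inverse matrix applied to the coordinates of \<open>x\<close> gives a
        preimage under f - 1.\<close>
      obtain a where a: "a \<in> carrier A" "coord_vec a = B *\<^sub>v coord_vec x"
        using B(1) by (metis coord_vec_surj coord_vec_carrier mult_mat_vec_carrier)
      have "coord_vec (f a \<otimes> inv a) = (?M * B) *\<^sub>v coord_vec x"
        using a B(1) M by (simp add: coord_vec_diff assoc_mult_mat_vec[of _ n n _ n])
      then have "f a \<otimes> inv a = x"
        using a x by (intro coord_vec_inject) (simp_all add: B(2))
      with a show ?thesis
        by (auto simp: aut_diff_def)
    qed
    with subgroup.subset[OF subgroup_aut_diff] show ?thesis
      by blast
  qed
  moreover have "?M \<in> GL_int n" if surj: "aut_diff A f = carrier A"
  proof -
    have "\<exists>a. a \<in> carrier A \<and> b k = f a \<otimes> inv a" if "k < n" for k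
      using b_closed[OF that] surj by (auto simp: aut_diff_def)
    then obtain a where a: "\<And>k. k < n \<Longrightarrow> a k \<in> carrier A"
      "\<And>k. k < n \<Longrightarrow> b k = f (a k) \<otimes> inv (a k)"
      by metis
    \<comment> \<open>Column \<open>k\<close> holds the coordinates of a chosen preimage of the
      basis element \<open>b k\<close>.\<close>
    define B where "B = mat n n (\<lambda>(j, k). c (a k) j)"
    have B: "B \<in> carrier_mat n n"
      by (simp add: B_def)
    have "?M * B = 1\<^sub>m n"
    proof (rule eq_matI)
      fix i k assume "i < dim_row (1\<^sub>m n :: int mat)" "k < dim_col (1\<^sub>m n :: int mat)"
      then have ik: "i < n" "k < n"
        by simp_all
      then have "col B k = coord_vec (a k)"
        by (auto simp: B_def coord_vec_def)
      then have "(?M * B) $$ (i, k) = (?M *\<^sub>v coord_vec (a k)) $ i"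
        using ik B by simp
      also have "\<dots> = coord_vec (b k) $ i"
        using ik a by (simp flip: coord_vec_diff)
      also have "\<dots> = 1\<^sub>m n $$ (i, k)"
        using ik by (simp add: coord_vec_def c_b)
      finally show "(?M * B) $$ (i, k) = 1\<^sub>m n $$ (i, k)" .
    qed (use B in simp_all)
    with B M int_mat_right_inverse_imp_left_inverse[OF M B] show ?thesis
      by (auto simp: GL_int_def Units_def ring_mat_simps)
  qed
  ultimately show ?thesis
    unfolding endo_matrix_eq by blast
qed

end

section \<open>Abelianization\<close>

context group
begin

lemma normal_lower_central_2: "lower_central G 2 \<lhd> G"
  unfolding lower_central_2 by (rule derived_self_is_normal)

lemma comm_group_abelianization: "comm_group (abelianization G)"
  unfolding abelianization_def lower_central_2 by (rule derived_quot_is_comm_group)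

lemma carrier_abelianization:
  "carrier (abelianization G) = (\<lambda>x. lower_central G 2 #> x) ` carrier G"
  by (simp add: abelianization_def carrier_FactGroup)

lemma coset_hom_abelianization: "(\<lambda>x. lower_central G 2 #> x) \<in> hom G (abelianization G)"
  unfolding abelianization_def by (rule normal.r_coset_hom_Mod[OF normal_lower_central_2])

lemma mem_coset_abelianization: "x \<in> carrier G \<Longrightarrow> x \<in> lower_central G 2 #> x"
  using normal_lower_central_2 by (intro rcos_self normal_imp_subgroup)

lemma coset_subset_carrier:
  assumes "C \<in> carrier (abelianization G)"
  shows "C \<subseteq> carrier G"
proof -
  interpret D: subgroup "lower_central G 2" G
    using normal_lower_central_2 by (rule normal_imp_subgroup)
  from assms show ?thesis
    by (auto simp: carrier_abelianization r_coset_def)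
qed

lemma coset_abelianization_eq_one:
  assumes "x \<in> carrier G" "lower_central G 2 #> x = \<one>\<^bsub>abelianization G\<^esub>"
  shows "x \<in> lower_central G 2"
  using assms mem_coset_abelianization[OF assms(1)] by (simp add: abelianization_def)

end

context group_auto
begin

lemma f_bij: "bij_betw f (carrier N) (carrier N)"
  using f_auto by (simp add: auto_def Bij_def)

text \<open>A homomorphism sends the derived subgroup onto that of its image, and \<open>f\<close>
  is surjective.\<close>

lemma f_image_lower_central_2: "f ` lower_central N 2 = lower_central N 2"
proof -
  interpret f: group_hom N N f
    using f_hom by unfold_locales
  show ?thesis
    using f.derived_img[of "carrier N"] f_bij by (simp add: lower_central_2 bij_betw_def)
qed

lemma induced_auto_coset:
  assumes x: "x \<in> carrier N"
  shows "induced_auto N f (lower_central N 2 #> x) = lower_central N 2 #> f x"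
proof -
  interpret D: subgroup "lower_central N 2" N
    using normal_lower_central_2 by (rule normal_imp_subgroup)
  have "f ` (lower_central N 2 #> x) = (f ` lower_central N 2) #> f x"
    using x by (auto simp: r_coset_def f_mult image_iff)
  then show ?thesis
    using x by (simp add: induced_auto_def carrier_abelianization f_image_lower_central_2)
qed

lemma induced_auto_auto: "induced_auto N f \<in> auto (abelianization N)"
proof -
  let ?D = "lower_central N 2" and ?g = "induced_auto N f" and ?A = "abelianization N"
  have mult: "(?D #> x) \<otimes>\<^bsub>?A\<^esub> (?D #> y) = ?D #> (x \<otimes> y)"
    if "x \<in> carrier N" "y \<in> carrier N" for x y
    using hom_mult[OF coset_hom_abelianization that] by simp
  have "?g \<in> hom ?A ?A"
    by (rule homI) (auto simp: carrier_abelianization induced_auto_coset mult f_mult)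
  moreover have "?g \<in> extensional (carrier ?A)"
    by (simp add: induced_auto_def)
  moreover have "bij_betw ?g (carrier ?A) (carrier ?A)"
    unfolding bij_betw_def
  proof
    \<comment> \<open>Cosets are subsets of the carrier, and the injective \<open>f\<close> has
      distinct images on distinct subsets.\<close>
    show "inj_on ?g (carrier ?A)"
      using f_bij coset_subset_carrier
      by (intro inj_onI)
         (simp add: induced_auto_def inj_on_image_eq_iff[of f "carrier N"] bij_betw_def)
    have "?g ` carrier ?A = (\<lambda>x. ?D #> f x) ` carrier N"
      by (simp add: carrier_abelianization image_image induced_auto_coset)
    also have "\<dots> = (\<lambda>x. ?D #> x) ` f ` carrier N"
      by (simp add: image_image)
    also have "\<dots> = carrier ?A"
      using f_bij by (simp add: carrier_abelianization bij_betw_def)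
    finally show "?g ` carrier ?A = carrier ?A" .
  qed
  ultimately show ?thesis
    by (simp add: auto_def Bij_def)
qed

end

section \<open>The abelianization of a free group\<close>

text \<open>An arbitrary representative may be chosen: exponent sums vanish on the derived subgroup
  and so are constant on its cosets.\<close>

definition ab_coord :: "letter list set \<Rightarrow> nat \<Rightarrow> int" where
  "ab_coord C i = exponent_sum (SOME w. w \<in> C) i"

lemma ab_coord_coset:
  assumes w: "w \<in> carrier (free_group n)"
  shows "ab_coord (lower_central (free_group n) 2 #>\<^bsub>free_group n\<^esub> w) i = exponent_sum w i"
proof -
  interpret F: group "free_group n" by (rule group_free_group)
  let ?D = "lower_central (free_group n) 2"
  have "w \<in> ?D #>\<^bsub>free_group n\<^esub> w"
    using w by (rule F.mem_coset_abelianization)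
  then have "(SOME v. v \<in> ?D #>\<^bsub>free_group n\<^esub> w) \<in> ?D #>\<^bsub>free_group n\<^esub> w"
    by (rule someI)
  then obtain d where "d \<in> ?D"
    "(SOME v. v \<in> ?D #>\<^bsub>free_group n\<^esub> w) = d \<otimes>\<^bsub>free_group n\<^esub> w"
    unfolding r_coset_def by blast
  then show ?thesis
    by (simp add: ab_coord_def exponent_sum_mult exponent_sum_derived)
qed

lemma free_gen_closed: "i < n \<Longrightarrow> free_gen i \<in> carrier (free_group n)"
  by (simp add: free_gen_def carrier_free_group reduced_def)

text \<open>The exponent is 1 or -1, which treats generators and their inverses uniformly.\<close>

lemma singleton_letter:
  assumes "fst a < n"
  shows "[a] = free_gen (fst a) [^]\<^bsub>free_group n\<^esub> exponent_sum [a] (fst a)"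
proof -
  interpret F: group "free_group n" by (rule group_free_group)
  note closed = free_gen_closed[OF assms]
  show ?thesis
  proof (cases "snd a")
    case True
    then show ?thesis
      using closed by (cases a) (simp add: exponent_sum_def free_gen_def)
  next
    case False
    have "[a] \<otimes>\<^bsub>free_group n\<^esub> free_gen (fst a) = \<one>\<^bsub>free_group n\<^esub>"
      using False
      by (cases a)
         (simp add: mult_free_group one_free_group push_letter_def free_gen_def inv_letter_def)
    moreover have "[a] \<in> carrier (free_group n)"
      using assms by (simp add: carrier_free_group reduced_def)
    ultimately have "inv\<^bsub>free_group n\<^esub> free_gen (fst a) = [a]"
      using closed by (intro F.inv_equality)
    with False closed show ?thesis
      by (simp add: exponent_sum_def F.int_pow_neg)
  qed
qed

text \<open>Each letter contributes a power of one generator, and in the abelianization these powers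
  can be collected. Hence exponent sums determine a coset.\<close>

lemma free_group_coset_eq_finprod:
  fixes n :: nat
  defines "F \<equiv> free_group n"
  defines "A \<equiv> abelianization F"
  assumes "w \<in> carrier F"
  shows "lower_central F 2 #>\<^bsub>F\<^esub> w
    = finprod A (\<lambda>i. free_ab_gen n i [^]\<^bsub>A\<^esub> exponent_sum w i) {..<n}"
proof -
  interpret F: group F
    unfolding F_def by (rule group_free_group)
  interpret A: comm_group A
    unfolding A_def by (rule F.comm_group_abelianization)
  define p where "p = (\<lambda>x. lower_central F 2 #>\<^bsub>F\<^esub> x)"
  interpret p: group_hom F A p
    using F.coset_hom_abelianization by unfold_locales (simp add: p_def A_def)
  let ?b = "free_ab_gen n"
  have b: "?b i = p (free_gen i)" for i
    by (simp add: p_def F_def free_ab_gen_def)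
  have b_closed: "?b i \<in> carrier A" if "i < n" for i
    unfolding b using free_gen_closed[OF that] F_def by simp
  have "p w = finprod A (\<lambda>i. ?b i [^]\<^bsub>A\<^esub> exponent_sum w i) {..<n}"
    using assms(3)
  proof (induction w)
    case Nil
    have "p [] = \<one>\<^bsub>A\<^esub>"
      using p.hom_one by (simp add: F_def one_free_group)
    then show ?case
      by simp
  next
    case (Cons a w)
    \<comment> \<open>As \<open>a # w\<close> is reduced, pushing \<open>a\<close> cancels nothing,
      so this word really is the product of \<open>[a]\<close> and \<open>w\<close>.\<close>
    from Cons.prems have w: "w \<in> carrier F" and a: "fst a < n" and red: "push_letter a w = a # w"
      by (auto simp: F_def carrier_free_group reduced_Cons push_letter_def)
    have a_closed: "[a] \<in> carrier F"
      using a by (simp add: F_def carrier_free_group reduced_def)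
    have "p [a] = ?b (fst a) [^]\<^bsub>A\<^esub> exponent_sum [a] (fst a)"
      using arg_cong[OF singleton_letter[OF a], of p] free_gen_closed[OF a]
      by (simp add: b F_def[symmetric] p.hom_int_pow)
    \<comment> \<open>The single power is spread over all indices with trivial factors elsewhere, to
      be merged factor by factor with the product for \<open>w\<close>.\<close>
    also have "\<dots> = finprod A
        (\<lambda>i. if fst a = i then ?b i [^]\<^bsub>A\<^esub> exponent_sum [a] i else \<one>\<^bsub>A\<^esub>) {..<n}"
      using a b_closed by (intro A.finprod_singleton[symmetric]) auto
    also have "\<dots> = finprod A (\<lambda>i. ?b i [^]\<^bsub>A\<^esub> exponent_sum [a] i) {..<n}"
      using b_closed by (intro A.finprod_cong') (auto simp: exponent_sum_def)
    finally have pa: "p [a] = \<dots>" .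
    have "a # w = [a] \<otimes>\<^bsub>F\<^esub> w"
      using red by (simp add: F_def mult_free_group)
    then have "p (a # w) = p [a] \<otimes>\<^bsub>A\<^esub> p w"
      using a_closed w by simp
    also have "\<dots> = finprod A
        (\<lambda>i. ?b i [^]\<^bsub>A\<^esub> exponent_sum [a] i \<otimes>\<^bsub>A\<^esub> ?b i [^]\<^bsub>A\<^esub> exponent_sum w i) {..<n}"
      unfolding pa Cons.IH[OF w] using b_closed by (intro A.finprod_multf[symmetric]) auto
    also have "\<dots> = finprod A (\<lambda>i. ?b i [^]\<^bsub>A\<^esub> exponent_sum (a # w) i) {..<n}"
      using b_closed
      by (intro A.finprod_cong') (auto simp: exponent_sum_Cons[of a w] A.int_pow_mult)
    finally show ?case .
  qed
  then show ?thesis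
    by (simp add: p_def)
qed

lemma coordinates_abelianization:
  assumes "\<phi> \<in> auto (free_group n)"
  shows "coordinates (abelianization (free_group n)) (induced_auto (free_group n) \<phi>) n
    (free_ab_gen n) ab_coord"
proof -
  interpret F: group_auto "free_group n" \<phi>
    using assms group_free_group by (simp add: group_auto_def group_auto_axioms_def)
  let ?p = "\<lambda>x. lower_central (free_group n) 2 #>\<^bsub>free_group n\<^esub> x"
  let ?A = "abelianization (free_group n)"
  interpret A: comm_group ?A
    by (rule F.comm_group_abelianization)
  show ?thesis
  proof unfold_locales
    show "induced_auto (free_group n) \<phi> \<in> auto ?A"
      by (rule F.induced_auto_auto)
  next
    fix i assume "i < n"
    then show "free_ab_gen n i \<in> carrier ?A"
      by (simp add: free_ab_gen_def F.carrier_abelianization free_gen_closed)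
  next
    fix x y i assume "x \<in> carrier ?A" "y \<in> carrier ?A"
    then obtain u v where uv: "u \<in> carrier (free_group n)" "x = ?p u"
      "v \<in> carrier (free_group n)" "y = ?p v"
      by (auto simp: F.carrier_abelianization)
    then have "x \<otimes>\<^bsub>?A\<^esub> y = ?p (u \<otimes>\<^bsub>free_group n\<^esub> v)"
      using hom_mult[OF F.coset_hom_abelianization] by simp
    with uv show "ab_coord (x \<otimes>\<^bsub>?A\<^esub> y) i = ab_coord x i + ab_coord y i"
      by (simp add: ab_coord_coset exponent_sum_mult)
  next
    fix i j assume "i < n" "j < n"
    then show "ab_coord (free_ab_gen n j) i = (if i = j then 1 else 0)"
      by (simp add: free_ab_gen_def ab_coord_coset free_gen_closed exponent_sum_free_gen)
  next
    fix x assume "x \<in> carrier ?A"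
    then obtain w where w: "w \<in> carrier (free_group n)" "x = ?p w"
      by (auto simp: F.carrier_abelianization)
    then have "ab_coord x = exponent_sum w"
      by (simp add: fun_eq_iff ab_coord_coset)
    with w free_group_coset_eq_finprod[OF w(1)]
    show "x = finprod ?A (\<lambda>i. free_ab_gen n i [^]\<^bsub>?A\<^esub> ab_coord x i) {..<n}"
      by (simp only:)
  qed
qed

section \<open>Reduction of all the conditions to surjectivity of the induced automorphism minus the
  identity\<close>

theorem proposition5p2:
  fixes n :: nat and \<phi> :: "letter list \<Rightarrow> letter list"
  assumes "\<phi> \<in> auto (free_group n)"
  defines "F \<equiv> free_group n"
  defines "Fab \<equiv> abelianization F"
  defines "\<phi>ab \<equiv> induced_auto F \<phi>"
  defines "G \<equiv> semidirect_int F \<phi>"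
  defines "Gbar \<equiv> semidirect_int Fab \<phi>ab"
  shows "(lower_central_omega G = semidirect_kernel F
            \<longleftrightarrow> lower_central_omega Gbar = semidirect_kernel Fab)
       \<and> (lower_central_omega Gbar = semidirect_kernel Fab
            \<longleftrightarrow> endo_matrix Fab n (free_ab_gen n) \<phi>ab - 1\<^sub>m n \<in> GL_int n)
       \<and> (endo_matrix Fab n (free_ab_gen n) \<phi>ab - 1\<^sub>m n \<in> GL_int n
            \<longleftrightarrow> ideal_smult Fab \<phi>ab augmentation_ideal = carrier Fab)"
proof -
  interpret F: group_auto F \<phi>
    using assms(1) group_free_group by (simp add: F_def group_auto_def group_auto_axioms_def)
  interpret A: coordinates Fab \<phi>ab n "free_ab_gen n" ab_coord
    using coordinates_abelianization[OF assms(1)] by (simp add: Fab_def \<phi>ab_def F_def)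
  have "lower_central_omega G = semidirect_kernel F \<longleftrightarrow> aut_diff Fab \<phi>ab = carrier Fab"
    unfolding G_def
  proof (rule F.lower_central_omega_semidirect_int)
    show "\<phi>ab \<in> auto Fab"
      by (rule A.f_auto)
    show "(\<lambda>x. lower_central F 2 #>\<^bsub>F\<^esub> x) \<in> hom F Fab"
      unfolding Fab_def by (rule F.coset_hom_abelianization)
    show "(\<lambda>x. lower_central F 2 #>\<^bsub>F\<^esub> x) ` carrier F = carrier Fab"
      by (simp add: Fab_def F.carrier_abelianization)
    show "x \<in> lower_central F 2"
      if "x \<in> carrier F" "lower_central F 2 #>\<^bsub>F\<^esub> x = \<one>\<^bsub>Fab\<^esub>" for x
      using that unfolding Fab_def by (rule F.coset_abelianization_eq_one)
  qed (simp_all add: A.comm_group_axioms \<phi>ab_def F.induced_auto_coset)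
  \<comment> \<open>For the abelian factor the criterion is used with \<open>\<pi>\<close> the
    identity, whose kernel is trivial, so the same group and automorphism appear as for the free
    group.\<close>
  moreover have "lower_central_omega Gbar = semidirect_kernel Fab \<longleftrightarrow> aut_diff Fab \<phi>ab = carrier Fab"
    unfolding Gbar_def
  proof (rule A.lower_central_omega_semidirect_int)
    show "(\<lambda>x. x) \<in> hom Fab Fab"
      by (simp add: hom_def)
    show "x \<in> lower_central Fab 2" if "x = \<one>\<^bsub>Fab\<^esub>" for x
      using that by (simp add: lower_central_2 derived_def generate.one)
  qed (simp_all add: A.comm_group_axioms A.f_auto)
  ultimately show ?thesis
    using A.matr_minus_one_GL_iff A.ideal_smult_augmentation_ideal by simp
qed

end
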